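(* Let $\mathbb{X},\mathbb{Y}$ be Euclidean spaces, $g:\mathbb{X}\to\mathbb{R}$ a continuous convex function, $\Phi:\mathbb{X}\to\mathbb{Y}$ a linear operator, $y_0\in\mathbb{Y}$, and let $x_0\in\mathbb{X}$ be a feasible point, i.e. $\Phi x_0=y_0$. Set $\Delta(x_0):=\partial g(x_0)\cap\operatorname{Im}\Phi^*$. The following are equivalent: (i) $x_0$ is a unique optimal solution of the problem $\min_{x\in\mathbb{X}} g(x)$ subject to $\Phi x=y_0$. (ii) $\Delta(x_0)\neq\emptyset$, and for any $y\in\Delta(x_0)$ one has $\operatorname{Ker}\Phi\cap\mathcal{R}_{\partial g^*(y)}(x_0)=\{0\}$. (iii) $\Delta(x_0)\neq\emptyset$, and there exists $\bar y\in\Delta(x_0)$ such that $\operatorname{Ker}\Phi\cap\mathcal{R}_{\partial g^*(\bar y)}(x_0)=\{0\}$.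
   Context: $\Phi^*$ is the adjoint of $\Phi$. The condition $\Delta(x_0)\ne\emptyset$ is called the Source Condition, and elements of $\Delta(x_0)$ are called dual certificates. $\partial$ is the convex subdifferential; $g^*$ is the Legendre-Fenchel conjugate, with $\partial g^*(y)=\{x\in\mathbb{X}\mid y\in\partial g(x)\}$. For a closed convex set $\Omega$ and $x_0\in\Omega$, the radial cone is $\mathcal{R}_\Omega(x_0)=\mathbb{R}_+(\Omega-x_0)$. *)

theory Defs
  imports "HOL-Analysis.Analysis"
begin

text \<open>Functions are extended-real-valued so that the convex subdifferential also applies to a
  conjugate, which may take the value \<open>\<infinity>\<close>. By the usual convention the
  subdifferential is empty wherever the function is not finite.\<close>

definition subdifferential :: "('a::real_inner \<Rightarrow> ereal) \<Rightarrow> 'a \<Rightarrow> 'a set" where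
  "subdifferential f x =
     {v. \<bar>f x\<bar> \<noteq> \<infinity> \<and> (\<forall>z. f x + ereal (v \<bullet> (z - x)) \<le> f z)}"

definition fenchel_conjugate :: "('a::real_inner \<Rightarrow> ereal) \<Rightarrow> 'a \<Rightarrow> ereal" where
  "fenchel_conjugate f y = (SUP x. ereal (y \<bullet> x) - f x)"

definition radial_cone :: "'a::real_vector set \<Rightarrow> 'a \<Rightarrow> 'a set" where
  "radial_cone \<Omega> x = {t *\<^sub>R (w - x) | t w. 0 \<le> t \<and> w \<in> \<Omega>}"

definition dual_certificate_set ::
  "('a::euclidean_space \<Rightarrow> real) \<Rightarrow> ('a \<Rightarrow> 'b::euclidean_space) \<Rightarrow> 'a \<Rightarrow> 'a set" where
  "dual_certificate_set g \<Phi> x =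
     subdifferential (\<lambda>z. ereal (g z)) x \<inter> range (adjoint \<Phi>)"

definition optimal_solutions ::
  "('a \<Rightarrow> real) \<Rightarrow> ('a \<Rightarrow> 'b) \<Rightarrow> 'b \<Rightarrow> 'a set" where
  "optimal_solutions g \<Phi> b = {x. is_arg_min g (\<lambda>z. \<Phi> z = b) x}"

lemma mem_subdifferential_real_iff:
  "v \<in> subdifferential (\<lambda>z. ereal (g z)) x \<longleftrightarrow> (\<forall>z. g x + v \<bullet> (z - x) \<le> g z)"
  by (simp add: subdifferential_def)

end

theory Submission
  imports Defs
begin

text \<open>
  Every dual certificate \<open>y\<close> describes the whole solution set: \<open>y\<close> is orthogonal to
  \<open>Ker \<Phi>\<close>, so the affine minorant \<open>g x0 + y \<bullet> (z - x0)\<close> of \<open>g\<close> is constant on the feasible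
  affine space, and a feasible point is optimal exactly when \<open>g\<close> touches this minorant there, that is,
  when \<open>y\<close> is a subgradient of \<open>g\<close> at that point.  By conjugate duality these touching points
  form \<open>\<partial>g\<^sup>*(y)\<close>, so the solution set is the feasible part of \<open>\<partial>g\<^sup>*(y)\<close>
  (\<open>optimal_solutions_eq_feasible_conjugate_subgradients\<close>).

  The radial cone of a set at \<open>x0\<close> meets \<open>Ker \<Phi>\<close> only in \<open>0\<close> exactly when the set has no feasible
  point besides \<open>x0\<close>, because scaling does not leave the kernel
  (\<open>kernel_Int_radial_cone_trivial_iff\<close>).  Hence for each single certificate the cone condition
  is equivalent to uniqueness, which is why ``for all certificates'' and ``for some certificate'' agree.

  What remains is that an optimal point has a certificate.  This is a separation argument:
  optimality says that the epigraph of \<open>g\<close> misses the set of points lying strictly below height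
  \<open>g x0\<close> over the feasible space, and a separating hyperplane is the graph of a minorant whose slope is
  orthogonal to the kernel (\<open>subgradient_orthogonal_to_subspace\<close>).
\<close>

section \<open>Subgradients at constrained minimisers\<close>

text \<open>The Fermat rule for minimisation over an affine space.  With \<open>K = {0}\<close> the minimality
  hypothesis is void and the lemma says that a finite convex function has a subgradient at every
  point.\<close>

lemma subgradient_orthogonal_to_subspace:
  fixes g :: "'a::euclidean_space \<Rightarrow> real"
  assumes g: "convex_on UNIV g" and K: "subspace K"
    and min: "\<And>k. k \<in> K \<Longrightarrow> g x \<le> g (x + k)"
  obtains v where "v \<in> subdifferential (\<lambda>z. ereal (g z)) x" "\<And>k. k \<in> K \<Longrightarrow> v \<bullet> k = 0"
proof -
  define B where "B = (+) x ` K \<times> {..<g x}"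
  have "convex B"
    unfolding B_def using K by (simp add: convex_Times convex_translation subspace_imp_convex)
  moreover have "convex (epigraph UNIV g)"
    using g by (simp add: convex_epigraph)
  moreover have "(x, g x - 1) \<in> B" "(x, g x) \<in> epigraph UNIV g"
    using subspace_0[OF K] by (force simp: B_def epigraph_def)+
  moreover have "B \<inter> epigraph UNIV g = {}"
    using min by (fastforce simp: B_def epigraph_def)
  ultimately obtain ab c where ab0: "ab \<noteq> 0"
    and below: "\<forall>p\<in>B. ab \<bullet> p \<le> c" and above: "\<forall>p\<in>epigraph UNIV g. ab \<bullet> p \<ge> c"
    using separating_hyperplane_sets[of B "epigraph UNIV g"] by blast
  obtain a b where ab: "ab = (a, b)"
    by fastforce
  have lower: "a \<bullet> (x + k) + b * s \<le> c" if "k \<in> K" "s < g x" for k s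
    using below that by (force simp: B_def ab)
  have upper: "c \<le> a \<bullet> z + b * t" if "g z \<le> t" for z t
    using above that by (force simp: epigraph_def ab)
  have "a \<bullet> x + b * (g x - 1) \<le> a \<bullet> x + b * g x"
    using order_trans[OF lower[of 0 "g x - 1"] upper[of x "g x"]] subspace_0[OF K] by simp
  then have "b \<ge> 0"
    by (simp add: algebra_simps)
  \<comment> \<open>A vertical hyperplane is impossible: the epigraph projects onto the whole space, on which a
    nonzero linear form is unbounded.\<close>
  have "b \<noteq> 0"
  proof
    assume "b = 0"
    then have "a \<bullet> x \<le> a \<bullet> (x - a)"
      using order_trans[OF lower[of 0 "g x - 1"] upper[of "x - a" "g (x - a)"]] subspace_0[OF K]
      by simp
    then have "a \<bullet> a \<le> 0"
      by (simp add: inner_diff_right)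
    then have "a = 0"
      by (meson inner_gt_zero_iff not_le)
    with ab0 ab \<open>b = 0\<close> show False
      by (simp add: zero_prod_def)
  qed
  with \<open>b \<ge> 0\<close> have "b > 0"
    by simp
  \<comment> \<open>Below height \<open>g x\<close> the points of \<open>B\<close> come arbitrarily close to that height.\<close>
  have lower': "a \<bullet> (x + k) + b * g x \<le> c" if "k \<in> K" for k
  proof (rule field_le_epsilon)
    fix e :: real
    assume "e > 0"
    with \<open>b > 0\<close> lower[OF that, of "g x - e / b"]
    show "a \<bullet> (x + k) + b * g x \<le> c + e"
      by (simp add: right_diff_distrib)
  qed
  have orth: "a \<bullet> k = 0" if "k \<in> K" for k
  proof -
    have "a \<bullet> k' \<le> 0" if "k' \<in> K" for k'
      using order_trans[OF lower'[OF that] upper[of x "g x"]] by (simp add: inner_add_right)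
    from this[of k] this[of "- k"] that K show ?thesis
      by (simp add: subspace_neg)
  qed
  show thesis
  proof
    show "(- (1 / b)) *\<^sub>R a \<in> subdifferential (\<lambda>z. ereal (g z)) x"
      unfolding mem_subdifferential_real_iff
    proof
      fix z
      have "b * g x \<le> a \<bullet> (z - x) + b * g z"
        using order_trans[OF lower'[of 0] upper[of z "g z"]] subspace_0[OF K]
        by (simp add: inner_diff_right)
      with \<open>b > 0\<close> show "g x + (- (1 / b)) *\<^sub>R a \<bullet> (z - x) \<le> g z"
        by (simp add: field_simps)
    qed
    show "(- (1 / b)) *\<^sub>R a \<bullet> k = 0" if "k \<in> K" for k
      using orth[OF that] by simp
  qed
qed

section \<open>Subgradients of the conjugate\<close>

text \<open>Equality in the Fenchel-Young inequality.\<close>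

lemma fenchel_conjugate_eq_of_subgradient:
  assumes "y \<in> subdifferential (\<lambda>z. ereal (g z)) x"
  shows "fenchel_conjugate (\<lambda>z. ereal (g z)) y = ereal (y \<bullet> x - g x)"
  unfolding fenchel_conjugate_def
proof (rule antisym)
  show "(SUP z. ereal (y \<bullet> z) - ereal (g z)) \<le> ereal (y \<bullet> x - g x)"
    using assms by (force intro!: SUP_least simp: mem_subdifferential_real_iff inner_diff_right
        algebra_simps)
  show "ereal (y \<bullet> x - g x) \<le> (SUP z. ereal (y \<bullet> z) - ereal (g z))"
    by (rule SUP_upper2[of x]) auto
qed

lemma fenchel_young:
  "ereal (y \<bullet> x - g x) \<le> fenchel_conjugate (\<lambda>z. ereal (g z)) y"
  unfolding fenchel_conjugate_def by (rule SUP_upper2[of x]) auto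

text \<open>Subgradient inversion.  The inclusion from left to right usually goes through the biconjugate
  theorem; for a finite convex function it is enough to test the subgradient inequality of the
  conjugate at one subgradient of \<open>g\<close> at \<open>x\<close>, where the conjugate is known explicitly.\<close>

lemma mem_subdifferential_fenchel_conjugate_iff:
  fixes g :: "'a::euclidean_space \<Rightarrow> real"
  assumes "convex_on UNIV g"
  shows "x \<in> subdifferential (fenchel_conjugate (\<lambda>z. ereal (g z))) y \<longleftrightarrow>
    y \<in> subdifferential (\<lambda>z. ereal (g z)) x"
proof
  let ?G = "fenchel_conjugate (\<lambda>z. ereal (g z))"
  assume x: "x \<in> subdifferential ?G y"
  then obtain r where r: "?G y = ereal r"
    by (auto simp: subdifferential_def)
  obtain v where v: "v \<in> subdifferential (\<lambda>z. ereal (g z)) x"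
    using subgradient_orthogonal_to_subspace[OF assms, of "{0}" x] by auto
  have "?G y + ereal (x \<bullet> (v - y)) \<le> ?G v"
    using x by (simp add: subdifferential_def)
  then have "r + x \<bullet> (v - y) \<le> v \<bullet> x - g x"
    by (simp add: r fenchel_conjugate_eq_of_subgradient[OF v])
  then have "r \<le> y \<bullet> x - g x"
    by (simp add: inner_diff_right inner_commute)
  moreover have "y \<bullet> z - g z \<le> r" for z
    using fenchel_young[of y z g] by (simp add: r)
  ultimately have "y \<bullet> z - g z \<le> y \<bullet> x - g x" for z
    by (meson order_trans)
  then show "y \<in> subdifferential (\<lambda>z. ereal (g z)) x"
    by (simp add: mem_subdifferential_real_iff inner_diff_right algebra_simps)
next
  let ?G = "fenchel_conjugate (\<lambda>z. ereal (g z))"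
  assume "y \<in> subdifferential (\<lambda>z. ereal (g z)) x"
  note G = fenchel_conjugate_eq_of_subgradient[OF this]
  have "?G y + ereal (x \<bullet> (z - y)) \<le> ?G z" for z
    using fenchel_young[of z x g] by (simp add: G inner_diff_right inner_commute)
  then show "x \<in> subdifferential ?G y"
    by (simp add: subdifferential_def G)
qed

section \<open>Dual certificates and the solution set\<close>

lemma adjoint_range_iff_orthogonal_kernel:
  fixes \<Phi> :: "'a::euclidean_space \<Rightarrow> 'b::euclidean_space"
  assumes "linear \<Phi>"
  shows "v \<in> range (adjoint \<Phi>) \<longleftrightarrow> (\<forall>k. \<Phi> k = 0 \<longrightarrow> v \<bullet> k = 0)"
proof -
  have "subspace (range (adjoint \<Phi>))"
    using assms by (simp add: adjoint_linear linear_subspace_image)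
  then have "range (adjoint \<Phi>) = orthogonal_comp (\<Phi> -` {0})"
    by (simp add: ker_orthogonal_comp_adjoint[OF assms] orthogonal_comp_self)
  then show ?thesis
    by (auto simp: orthogonal_comp_def orthogonal_def inner_commute)
qed

text \<open>The certificate does not occur on the left: the sets \<open>\<partial>g\<^sup>*(y)\<close> may differ from one
  certificate to another, but their feasible parts coincide.\<close>

lemma optimal_solutions_eq_feasible_conjugate_subgradients:
  fixes g :: "'a::euclidean_space \<Rightarrow> real"
    and \<Phi> :: "'a \<Rightarrow> 'b::euclidean_space"
  assumes g: "convex_on UNIV g" and \<Phi>: "linear \<Phi>"
    and y: "y \<in> dual_certificate_set g \<Phi> x0"
  shows "optimal_solutions g \<Phi> (\<Phi> x0) =
    {w \<in> subdifferential (fenchel_conjugate (\<lambda>x. ereal (g x))) y. \<Phi> w = \<Phi> x0}"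
proof -
  have sub: "g x0 + y \<bullet> (z - x0) \<le> g z" for z
    using y by (simp add: dual_certificate_set_def mem_subdifferential_real_iff)
  have flat: "y \<bullet> z = y \<bullet> x0" if "\<Phi> z = \<Phi> x0" for z
  proof -
    have "\<Phi> (z - x0) = 0"
      using that \<Phi> by (simp add: linear_diff)
    moreover have "y \<in> range (adjoint \<Phi>)"
      using y by (simp add: dual_certificate_set_def)
    ultimately have "y \<bullet> (z - x0) = 0"
      using adjoint_range_iff_orthogonal_kernel[OF \<Phi>] by blast
    then show ?thesis
      by (simp add: inner_diff_right)
  qed
  have opt: "w \<in> optimal_solutions g \<Phi> (\<Phi> x0) \<longleftrightarrow> \<Phi> w = \<Phi> x0 \<and> g w = g x0" for w
  proof -
    have "g x0 \<le> g z" if "\<Phi> z = \<Phi> x0" for z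
      using sub[of z] flat[OF that] by (simp add: inner_diff_right)
    then show ?thesis
      by (force simp: optimal_solutions_def is_arg_min_linorder)
  qed
  have touch: "y \<in> subdifferential (\<lambda>z. ereal (g z)) w \<longleftrightarrow> g w = g x0" if w: "\<Phi> w = \<Phi> x0" for w
  proof
    assume "y \<in> subdifferential (\<lambda>z. ereal (g z)) w"
    then have "g w + y \<bullet> (x0 - w) \<le> g x0"
      by (simp add: mem_subdifferential_real_iff)
    with sub[of w] flat[OF w] show "g w = g x0"
      by (simp add: inner_diff_right)
  next
    assume "g w = g x0"
    with sub flat[OF w] show "y \<in> subdifferential (\<lambda>z. ereal (g z)) w"
      by (simp add: mem_subdifferential_real_iff inner_diff_right)
  qed
  show ?thesis
    using opt touch by (auto simp: mem_subdifferential_fenchel_conjugate_iff[OF g])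
qed

section \<open>Radial cones and uniqueness\<close>

text \<open>A direction \<open>t *\<^sub>R (w - x)\<close> with \<open>t > 0\<close> lies in the kernel only if \<open>w - x\<close> does.\<close>

lemma kernel_Int_radial_cone_trivial_iff:
  assumes \<Phi>: "linear \<Phi>" and x: "x \<in> \<Omega>"
  shows "{u. \<Phi> u = 0} \<inter> radial_cone \<Omega> x = {0} \<longleftrightarrow> {w \<in> \<Omega>. \<Phi> w = \<Phi> x} = {x}"
proof
  assume triv: "{u. \<Phi> u = 0} \<inter> radial_cone \<Omega> x = {0}"
  have "w = x" if "w \<in> \<Omega>" "\<Phi> w = \<Phi> x" for w
  proof -
    have "w - x = 1 *\<^sub>R (w - x)"
      by simp
    then have "w - x \<in> radial_cone \<Omega> x"
      using that unfolding radial_cone_def by fastforce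
    moreover have "\<Phi> (w - x) = 0"
      using that \<Phi> by (simp add: linear_diff)
    ultimately have "w - x \<in> {0}"
      using triv by blast
    then show ?thesis
      by simp
  qed
  with x show "{w \<in> \<Omega>. \<Phi> w = \<Phi> x} = {x}"
    by blast
next
  assume single: "{w \<in> \<Omega>. \<Phi> w = \<Phi> x} = {x}"
  have "t *\<^sub>R (w - x) = 0" if "w \<in> \<Omega>" "\<Phi> (t *\<^sub>R (w - x)) = 0" for t w
  proof (cases "t = 0")
    case False
    with that have "\<Phi> w = \<Phi> x"
      using \<Phi> by (simp add: linear_diff linear_scale)
    with that single have "w = x"
      by blast
    then show ?thesis
      by simp
  qed simp
  moreover have "0 \<in> radial_cone \<Omega> x"
    using x by (force simp: radial_cone_def)
  moreover have "\<Phi> 0 = 0"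
    using \<Phi> by (rule linear_0)
  ultimately show "{u. \<Phi> u = 0} \<inter> radial_cone \<Omega> x = {0}"
    unfolding radial_cone_def by blast
qed

theorem theorem4p5:
  fixes g :: "'a::euclidean_space \<Rightarrow> real"
    and \<Phi> :: "'a \<Rightarrow> 'b::euclidean_space"
    and y0 :: 'b and x0 :: 'a
  assumes "continuous_on UNIV g"
    and "convex_on UNIV g"
    and "linear \<Phi>"
    and "\<Phi> x0 = y0"
  shows "(optimal_solutions g \<Phi> y0 = {x0} \<longleftrightarrow>
            dual_certificate_set g \<Phi> x0 \<noteq> {} \<and>
            (\<forall>y \<in> dual_certificate_set g \<Phi> x0.
               {x. \<Phi> x = 0} \<inter>
               radial_cone (subdifferential (fenchel_conjugate (\<lambda>x. ereal (g x))) y) x0 = {0}))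
       \<and> (optimal_solutions g \<Phi> y0 = {x0} \<longleftrightarrow>
            dual_certificate_set g \<Phi> x0 \<noteq> {} \<and>
            (\<exists>y \<in> dual_certificate_set g \<Phi> x0.
               {x. \<Phi> x = 0} \<inter>
               radial_cone (subdifferential (fenchel_conjugate (\<lambda>x. ereal (g x))) y) x0 = {0}))"
proof -
  let ?D = "dual_certificate_set g \<Phi> x0"
  let ?trivial = "\<lambda>y. {x. \<Phi> x = 0} \<inter>
    radial_cone (subdifferential (fenchel_conjugate (\<lambda>x. ereal (g x))) y) x0 = {0}"
  have cone: "?trivial y \<longleftrightarrow> optimal_solutions g \<Phi> y0 = {x0}" if y: "y \<in> ?D" for y
  proof -
    have "x0 \<in> subdifferential (fenchel_conjugate (\<lambda>x. ereal (g x))) y"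
      using y by (simp add: mem_subdifferential_fenchel_conjugate_iff[OF assms(2)]
          dual_certificate_set_def)
    then show ?thesis
      using kernel_Int_radial_cone_trivial_iff[OF assms(3)]
        optimal_solutions_eq_feasible_conjugate_subgradients[OF assms(2,3) y] assms(4)
      by simp
  qed
  have certificate: "?D \<noteq> {}" if "optimal_solutions g \<Phi> y0 = {x0}"
  proof -
    have "x0 \<in> optimal_solutions g \<Phi> y0"
      using that by simp
    then have min: "g x0 \<le> g (x0 + k)" if "k \<in> {k. \<Phi> k = 0}" for k
      using that assms(3,4) by (simp add: optimal_solutions_def is_arg_min_linorder linear_add)
    have "subspace {k. \<Phi> k = 0}"
      using assms(3) by (rule linear_subspace_kernel)
    then obtain v where "v \<in> subdifferential (\<lambda>z. ereal (g z)) x0"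
      and "\<And>k. k \<in> {k. \<Phi> k = 0} \<Longrightarrow> v \<bullet> k = 0"
      using subgradient_orthogonal_to_subspace[OF assms(2) _ min] by blast
    then have "v \<in> ?D"
      by (simp add: dual_certificate_set_def adjoint_range_iff_orthogonal_kernel[OF assms(3)])
    then show ?thesis
      by blast
  qed
  show ?thesis
    using cone certificate by blast
qed

end
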